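(* Let $0<\gamma_1<\gamma_2<L$ with $\gamma_1+\gamma_2=L$. Consider the staircase discrete fracture network made of $N$ one-dimensional fractures $F_1,\dots,F_N$ with unit diffusion coefficients and homogeneous Dirichlet boundary conditions on every $F_j$, and the optimized Schwarz method (OSM) with all transmission parameters equal, $s_j^{+}=s_j^{-}=p$ for all $j$; let $T^D_N=M_N^{-1}N_N$ be its iteration matrix (all described explicitly in the context). Then the OSM is weakly scalable, in the following sense: for every $p>0$ there exists a constant $C<1$, independent of $N$, such that the spectral radius satisfies $$\rho(T^D_N)\le C<1\qquad\text{for all } N.$$
   Context: **Geometry.** The network is $\Omega=\bigcup_{j=1}^N F_j$, where each fracture $F_j$ is a segment of length $L$ with local coordinate $\tau_j\in[0,L]$. Consecutive fractures $F_j,F_{j+1}$ intersect at a single point (trace) $S_j$, $j=1,\dots,N-1$. The trace $S_j$ is at $\tau_j=\gamma_2$ in $F_j$ and at $\tau_{j+1}=\gamma_1$ in $F_{j+1}$. So $F_1$ has one trace (at $\gamma_2$), $F_N$ has one trace (at $\gamma_1$), and every other $F_j$ has two traces, $S_{j-1}$ at $\gamma_1$ and $S_j$ at $\gamma_2$. **Problem.** Find $u_j$ on $F_j$ with $-\partial_{\tau_j\tau_j}u_j=f_j$ in $F_j$, $u_j=0$ at $\tau_j=0$ and $\tau_j=L$, subject to $u_i=u_{i+1}$ and $[[\partial_{\tau_i}u_i]]+[[\partial_{\tau_{i+1}}u_{i+1}]]=0$ on $S_i$, $i=1,\dots,N-1$. Here $[[\partial_\tau v]]$ at a trace is the jump of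 the derivative there, namely the derivative from the left minus the derivative from the right. **OSM.** Given initial guesses $u_j^0$, for $n\ge1$ solve on each $F_j$: $-\partial_{\tau_j\tau_j}u^n_j=f_j$ (away from the traces), $u_j^n$ continuous, zero at the endpoints, with $$[[\partial_{\tau_j}u_j^n]]+p\,u_j^n=-[[\partial_{\tau_{j-1}}u_{j-1}^{n-1}]]+p\,u_{j-1}^{n-1}\ \text{ on } S_{j-1}\quad (j\ge2),$$ $$[[\partial_{\tau_j}u_j^n]]+p\,u_j^n=-[[\partial_{\tau_{j+1}}u_{j+1}^{n-1}]]+p\,u_{j+1}^{n-1}\ \text{ on } S_{j}\quad (j\le N-1).$$ **Iteration matrix.** The errors $e_j^n=u_j-u_j^n$ are piecewise linear on each fracture, and are determined by their values at the traces, collected in the vector $\mathbf e^n=(\hat e_1^n,\hat e_2^{1,n},\hat e_2^{2,n},\dots,\hat e_{N-1}^{1,n},\hat e_{N-1}^{2,n},\hat e_N^n)^\top\in\mathbb R^{\widetilde N}$, $\widetilde N=2(N-2)+2$, $N\ge 3$. Here $\hat e_j^{1,n},\hat e_j^{2,n}$ are the values of $e_j^n$ at $\tau_j=\gamma_1,\gamma_2$ respectively for $2\le j\le N-1$, and $\hat e_1^n,\hat e_N^n$ are the values of $e_1^n,e_N^n$ at their only trace. They satisfy $\mathbf e^n=T^D_N\mathbf e^{n-1}$ with $T^D_N=M_N^{-1}N_N$, where $M_N,N_N\in\mathbb R^{\widetilde N\times\widetilde N}$ are as follows. $M_N=\mathrm{diag}(F_1,F_2,\dots,F_2,F_4)$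 is block diagonal with $N-2$ copies of the $2\times2$ block $F_2$ (in this matrix $F_1,F_2,F_4$ denote the following blocks, not the fractures): $$F_1=p+\frac{L}{\gamma_2(L-\gamma_2)},\quad F_2=\begin{pmatrix}p+\frac{\gamma_2}{\gamma_1(\gamma_2-\gamma_1)}&-\frac1{\gamma_2-\gamma_1}\\-\frac1{\gamma_2-\gamma_1}&p+\frac{L-\gamma_1}{(L-\gamma_2)(\gamma_2-\gamma_1)}\end{pmatrix},\quad F_4=p+\frac{L}{\gamma_1(L-\gamma_1)}.$$ Let $$a=p-\frac{\gamma_2}{\gamma_1(\gamma_2-\gamma_1)},\quad b=\frac1{\gamma_2-\gamma_1},\quad c=p-\frac{L-\gamma_1}{(L-\gamma_2)(\gamma_2-\gamma_1)},\quad d_j=p-\frac{L}{\gamma_j(L-\gamma_j)}\ (j=1,2).$$ For $x=(x_1,x_2^1,x_2^2,\dots,x_{N-1}^1,x_{N-1}^2,x_N)^\top$, the vector $y=N_Nx$ (with the same indexing) is - $y_1=a\,x_2^1+b\,x_2^2$; - $y_2^1=d_2\,x_1$, and $y_j^1=b\,x_{j-1}^1+c\,x_{j-1}^2$ for $3\le j\le N-1$; - $y_j^2=a\,x_{j+1}^1+b\,x_{j+1}^2$ for $2\le j\le N-2$, and $y_{N-1}^2=d_1\,x_N$; - $y_N=b\,x_{N-1}^1+c\,x_{N-1}^2$. *)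

theory Defs
  imports Complex_Main "Jordan_Normal_Form.Gauss_Jordan_Elimination"
    "Jordan_Normal_Form.Spectral_Radius"
begin

text \<open>The iteration \<open>e\<^sup>n = T e\<^sup>n\<^sup>-\<^sup>1\<close> of the optimized Schwarz method on a staircase network of
  \<open>N\<close> fractures of length \<open>L\<close>, with traces at the local coordinates \<open>\<gamma>1 < \<gamma>2\<close> and transmission
  parameter \<open>p\<close>. The unknowns are the values of the errors at the traces, in the order
  \<open>(x\<^sub>1, x\<^sub>2\<^sup>1, x\<^sub>2\<^sup>2, \<dots>, x\<^sub>N\<^sub>-\<^sub>1\<^sup>1, x\<^sub>N\<^sub>-\<^sub>1\<^sup>2, x\<^sub>N)\<close>. Vector and matrix indices start at 0, so that
  \<open>x\<^sub>1\<close> has index \<open>0\<close>, \<open>x\<^sub>j\<^sup>1\<close> has index \<open>2j - 3\<close>, \<open>x\<^sub>j\<^sup>2\<close> has index \<open>2j - 2\<close>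
  (for \<open>2 \<le> j \<le> N - 1\<close>), and \<open>x\<^sub>N\<close> has index \<open>2N - 3\<close>.\<close>

definition osm_dim :: "nat \<Rightarrow> nat" where
  "osm_dim N = 2 * (N - 2) + 2"

definition blockF1 :: "real \<Rightarrow> real \<Rightarrow> real \<Rightarrow> real mat" where
  "blockF1 L \<gamma>2 p = mat_of_rows_list 1 [[p + L / (\<gamma>2 * (L - \<gamma>2))]]"

definition blockF2 :: "real \<Rightarrow> real \<Rightarrow> real \<Rightarrow> real \<Rightarrow> real mat" where
  "blockF2 L \<gamma>1 \<gamma>2 p = mat_of_rows_list 2
     [[p + \<gamma>2 / (\<gamma>1 * (\<gamma>2 - \<gamma>1)), - (1 / (\<gamma>2 - \<gamma>1))],
      [- (1 / (\<gamma>2 - \<gamma>1)), p + (L - \<gamma>1) / ((L - \<gamma>2) * (\<gamma>2 - \<gamma>1))]]"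

definition blockF4 :: "real \<Rightarrow> real \<Rightarrow> real \<Rightarrow> real mat" where
  "blockF4 L \<gamma>1 p = mat_of_rows_list 1 [[p + L / (\<gamma>1 * (L - \<gamma>1))]]"

definition osm_M :: "nat \<Rightarrow> real \<Rightarrow> real \<Rightarrow> real \<Rightarrow> real \<Rightarrow> real mat" where
  "osm_M N L \<gamma>1 \<gamma>2 p =
     diag_block_mat (blockF1 L \<gamma>2 p # replicate (N - 2) (blockF2 L \<gamma>1 \<gamma>2 p) @ [blockF4 L \<gamma>1 p])"

definition coef_a :: "real \<Rightarrow> real \<Rightarrow> real \<Rightarrow> real" where
  "coef_a \<gamma>1 \<gamma>2 p = p - \<gamma>2 / (\<gamma>1 * (\<gamma>2 - \<gamma>1))"

definition coef_b :: "real \<Rightarrow> real \<Rightarrow> real" where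
  "coef_b \<gamma>1 \<gamma>2 = 1 / (\<gamma>2 - \<gamma>1)"

definition coef_c :: "real \<Rightarrow> real \<Rightarrow> real \<Rightarrow> real \<Rightarrow> real" where
  "coef_c L \<gamma>1 \<gamma>2 p = p - (L - \<gamma>1) / ((L - \<gamma>2) * (\<gamma>2 - \<gamma>1))"

definition coef_d :: "real \<Rightarrow> real \<Rightarrow> real \<Rightarrow> real" where
  "coef_d L \<gamma> p = p - L / (\<gamma> * (L - \<gamma>))"

text \<open>Row \<open>r\<close> describes the datum received at one trace: rows \<open>1\<close> and \<open>2N - 4\<close> belong to the
  traces shared with the two end fractures, the other even rows (\<open>y\<^sub>1\<close> and \<open>y\<^sub>j\<^sup>2\<close>) receive data from
  the next fracture, and the other odd rows (\<open>y\<^sub>j\<^sup>1\<close> and \<open>y\<^sub>N\<close>) from the previous one. The action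
  on vectors is spelled out in \<open>osm_N_action\<close> below.\<close>

definition osm_N :: "nat \<Rightarrow> real \<Rightarrow> real \<Rightarrow> real \<Rightarrow> real \<Rightarrow> real mat" where
  "osm_N N L \<gamma>1 \<gamma>2 p = mat (osm_dim N) (osm_dim N) (\<lambda>(r, k).
     if r = 1 then (if k = 0 then coef_d L \<gamma>2 p else 0)
     else if r = 2 * N - 4 then (if k = 2 * N - 3 then coef_d L \<gamma>1 p else 0)
     else if even r then
       (if k = r + 1 then coef_a \<gamma>1 \<gamma>2 p else if k = r + 2 then coef_b \<gamma>1 \<gamma>2 else 0)
     else
       (if k = r - 2 then coef_b \<gamma>1 \<gamma>2 else if k = r - 1 then coef_c L \<gamma>1 \<gamma>2 p else 0))"

text \<open>The library function \<open>mat_inverse\<close> returns an option, which is \<open>None\<close> exactly for singular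
  matrices.\<close>

definition osm_T :: "nat \<Rightarrow> real \<Rightarrow> real \<Rightarrow> real \<Rightarrow> real \<Rightarrow> real mat" where
  "osm_T N L \<gamma>1 \<gamma>2 p = the (mat_inverse (osm_M N L \<gamma>1 \<gamma>2 p)) * osm_N N L \<gamma>1 \<gamma>2 p"

lemma osm_M_carrier: "osm_M N L \<gamma>1 \<gamma>2 p \<in> carrier_mat (osm_dim N) (osm_dim N)"
  by (rule carrier_matI)
    (simp_all add: osm_M_def dim_diag_block_mat blockF1_def blockF2_def blockF4_def osm_dim_def
      mat_of_rows_list_def sum_list_replicate)

lemma sum_two_deltas:
  fixes f :: "nat \<Rightarrow> real"
  assumes "k < n" "l < n" "k \<noteq> l"
  shows "(\<Sum>i = 0..<n. (if i = k then u else if i = l then v else 0) * f i) = u * f k + v * f l"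
proof -
  have "(\<Sum>i = 0..<n. (if i = k then u else if i = l then v else 0) * f i) =
        (\<Sum>i = 0..<n. (if i = k then u * f i else 0) + (if i = l then v * f i else 0))"
    using assms by (intro sum.cong) auto
  then show ?thesis
    using assms by (simp add: sum.distrib)
qed

lemma sum_one_delta:
  fixes f :: "nat \<Rightarrow> real"
  assumes "k < n"
  shows "(\<Sum>i = 0..<n. (if i = k then u else 0) * f i) = u * f k"
  using assms by (simp add: if_distrib[of "\<lambda>z. z * _"] cong: if_cong)

lemma osm_N_carrier: "osm_N N L \<gamma>1 \<gamma>2 p \<in> carrier_mat (osm_dim N) (osm_dim N)"
  by (simp add: osm_N_def)

lemma mat_vec_row:
  fixes A :: "real mat"
  assumes "A \<in> carrier_mat n n" "x \<in> carrier_vec n" "r < n"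
  shows "(A *\<^sub>v x) $ r = (\<Sum>k = 0..<n. A $$ (r, k) * x $ k)"
  using assms by (auto simp: scalar_prod_def intro!: sum.cong)

lemma osm_N_action:
  fixes L \<gamma>1 \<gamma>2 p :: real and x :: "real vec" and N :: nat
  defines "y \<equiv> osm_N N L \<gamma>1 \<gamma>2 p *\<^sub>v x"
    and "a \<equiv> coef_a \<gamma>1 \<gamma>2 p" and "b \<equiv> coef_b \<gamma>1 \<gamma>2" and "c \<equiv> coef_c L \<gamma>1 \<gamma>2 p"
    and "x1 \<equiv> \<lambda>j. x $ (2 * j - 3)" and "x2 \<equiv> \<lambda>j. x $ (2 * j - 2)"
    and "y1 \<equiv> \<lambda>j. (osm_N N L \<gamma>1 \<gamma>2 p *\<^sub>v x) $ (2 * j - 3)"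
    and "y2 \<equiv> \<lambda>j. (osm_N N L \<gamma>1 \<gamma>2 p *\<^sub>v x) $ (2 * j - 2)"
  assumes N: "N \<ge> 3" and x: "x \<in> carrier_vec (osm_dim N)"
  shows "y $ 0 = a * x1 2 + b * x2 2"
    and "y1 2 = coef_d L \<gamma>2 p * x $ 0"
    and "\<And>j. 3 \<le> j \<Longrightarrow> j \<le> N - 1 \<Longrightarrow> y1 j = b * x1 (j - 1) + c * x2 (j - 1)"
    and "\<And>j. 2 \<le> j \<Longrightarrow> j \<le> N - 2 \<Longrightarrow> y2 j = a * x1 (j + 1) + b * x2 (j + 1)"
    and "y2 (N - 1) = coef_d L \<gamma>1 p * x $ (2 * N - 3)"
    and "y $ (2 * N - 3) = b * x1 (N - 1) + c * x2 (N - 1)"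
proof -
  let ?n = "osm_dim N"
  let ?y = "osm_N N L \<gamma>1 \<gamma>2 p *\<^sub>v x"
  have n: "?n = 2 * N - 2" using N by (simp add: osm_dim_def)
  note row = mat_vec_row[OF osm_N_carrier x]
  have entry: "osm_N N L \<gamma>1 \<gamma>2 p $$ (r, k) =
     (if r = 1 then (if k = 0 then coef_d L \<gamma>2 p else 0)
      else if r = 2 * N - 4 then (if k = 2 * N - 3 then coef_d L \<gamma>1 p else 0)
      else if even r then (if k = r + 1 then a else if k = r + 2 then b else 0)
      else (if k = r - 2 then b else if k = r - 1 then c else 0))"
    if "r < ?n" "k < ?n" for r k
    unfolding osm_N_def a_def b_def c_def index_mat(1)[OF that] by (simp only: prod.case)
  have even_row: "?y $ r = a * x $ (r + 1) + b * x $ (r + 2)"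
    if r: "even r" "r + 2 < ?n" "r \<noteq> 2 * N - 4" for r
  proof -
    have "r < ?n" "r \<noteq> 1" using r by auto
    then have "?y $ r = (\<Sum>k = 0..<?n. (if k = r + 1 then a else if k = r + 2 then b else 0) * x $ k)"
      unfolding row[OF \<open>r < ?n\<close>] using r by (intro sum.cong refl) (simp only: entry atLeastLessThan_iff if_False if_True)
    then show ?thesis using r by (simp only: sum_two_deltas)
  qed
  have odd_row: "?y $ r = b * x $ (r - 2) + c * x $ (r - 1)"
    if r: "odd r" "r < ?n" "r \<ge> 3" for r
  proof -
    have "r \<noteq> 2 * N - 4" "r \<noteq> 1" using r by auto
    then have "?y $ r = (\<Sum>k = 0..<?n. (if k = r - 2 then b else if k = r - 1 then c else 0) * x $ k)"
      unfolding row[OF r(2)] using r by (intro sum.cong refl) (simp only: entry atLeastLessThan_iff if_False if_True)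
    also have "\<dots> = b * x $ (r - 2) + c * x $ (r - 1)"
      by (rule sum_two_deltas) (use r in auto)
    finally show ?thesis .
  qed
  show "y $ 0 = a * x1 2 + b * x2 2"
    using even_row[of 0] N n by (simp add: y_def x1_def x2_def numeral_2_eq_2)
  have bounds: "1 < ?n" "0 < ?n" "2 * N - 4 < ?n" "2 * N - 3 < ?n" "2 * N - 4 \<noteq> 1"
    using N n by auto
  have "?y $ 1 = (\<Sum>k = 0..<?n. (if k = 0 then coef_d L \<gamma>2 p else 0) * x $ k)"
    unfolding row[OF bounds(1)] using bounds(1)
    by (intro sum.cong refl) (simp only: entry atLeastLessThan_iff refl if_True)
  then show "y1 2 = coef_d L \<gamma>2 p * x $ 0"
    using bounds(2) by (simp add: y1_def sum_one_delta)
  have "?y $ (2 * N - 4) = (\<Sum>k = 0..<?n. (if k = 2 * N - 3 then coef_d L \<gamma>1 p else 0) * x $ k)"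
    unfolding row[OF bounds(3)] using bounds(3,5)
    by (intro sum.cong refl) (simp only: entry atLeastLessThan_iff refl if_True if_False)
  moreover have "2 * (N - 1) - 2 = 2 * N - 4" by simp
  ultimately show "y2 (N - 1) = coef_d L \<gamma>1 p * x $ (2 * N - 3)"
    by (simp only: y2_def sum_one_delta[OF bounds(4)])
  show "y $ (2 * N - 3) = b * x1 (N - 1) + c * x2 (N - 1)"
  proof -
    have "2 * (N - 1) - 3 = 2 * N - 3 - 2" "2 * (N - 1) - 2 = 2 * N - 3 - 1" by auto
    moreover have r: "odd (2 * N - 3)" "2 * N - 3 < ?n" "3 \<le> 2 * N - 3" using N n by auto
    ultimately show ?thesis
      using odd_row[OF r] by (simp only: y_def x1_def x2_def)
  qed
  show "y1 j = b * x1 (j - 1) + c * x2 (j - 1)" if "3 \<le> j" "j \<le> N - 1" for j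
  proof -
    have "2 * (j - 1) - 3 = 2 * j - 3 - 2" "2 * (j - 1) - 2 = 2 * j - 3 - 1" by auto
    moreover have r: "odd (2 * j - 3)" "2 * j - 3 < ?n" "3 \<le> 2 * j - 3" using that n by auto
    ultimately show ?thesis
      using odd_row[OF r] by (simp only: y1_def x1_def x2_def)
  qed
  show "y2 j = a * x1 (j + 1) + b * x2 (j + 1)" if "2 \<le> j" "j \<le> N - 2" for j
  proof -
    have "2 * (j + 1) - 3 = 2 * j - 2 + 1" "2 * (j + 1) - 2 = 2 * j - 2 + 2" using that by auto
    moreover have r: "even (2 * j - 2)" "2 * j - 2 + 2 < ?n" "2 * j - 2 \<noteq> 2 * N - 4"
      using that n by auto
    ultimately show ?thesis
      using even_row[OF r] by (simp only: y2_def x1_def x2_def)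
  qed
qed

end

theory Submission
  imports Defs
begin

text \<open>One has \<open>M = p + K\<close> and, up to the permutation of the rows that exchanges the two values at
  each trace, \<open>N = p - K\<close>, for a symmetric positive definite block diagonal matrix \<open>K\<close>. Its
  eigenvalues \<open>\<kappa>\<close> take only finitely many values, all positive and independent of the number of
  fractures; \<open>\<gamma>1 + \<gamma>2 = L\<close> makes them explicit. Hence \<open>\<parallel>N x\<parallel> \<le> C \<parallel>M x\<parallel>\<close> with
  \<open>C = max \<bar>p - \<kappa>\<bar> / (p + \<kappa>) < 1\<close>, and an eigenvector \<open>M\<^sup>-\<^sup>1 N x = \<lambda> x\<close>, that is
  \<open>N x = \<lambda> M x\<close>, has \<open>\<bar>\<lambda>\<bar> \<le> C\<close>.\<close>

section \<open>From norm comparison to spectral radius\<close>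

text \<open>A real matrix acts separately on real and imaginary parts. This carries inequalities
  proved for real vectors over to the possibly complex eigenvectors behind the spectral
  radius.\<close>

lemma sum_norm_square_of_real_mult_vec:
  fixes A :: "real mat" and v :: "complex vec"
  assumes A: "A \<in> carrier_mat n n" and v: "v \<in> carrier_vec n"
  shows "(\<Sum>r<n. (norm ((map_mat complex_of_real A *\<^sub>v v) $ r))\<^sup>2) =
    (\<Sum>r<n. ((A *\<^sub>v map_vec Re v) $ r)\<^sup>2) + (\<Sum>r<n. ((A *\<^sub>v map_vec Im v) $ r)\<^sup>2)"
  unfolding sum.distrib[symmetric]
proof (rule sum.cong[OF refl])
  fix r assume "r \<in> {..<n}"
  then have "Re ((map_mat complex_of_real A *\<^sub>v v) $ r) = (A *\<^sub>v map_vec Re v) $ r"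
    "Im ((map_mat complex_of_real A *\<^sub>v v) $ r) = (A *\<^sub>v map_vec Im v) $ r"
    using A v by (auto simp: scalar_prod_def intro!: sum.cong)
  then show "(norm ((map_mat complex_of_real A *\<^sub>v v) $ r))\<^sup>2 =
    ((A *\<^sub>v map_vec Re v) $ r)\<^sup>2 + ((A *\<^sub>v map_vec Im v) $ r)\<^sup>2"
    by (simp add: cmod_power2)
qed

lemma spectral_radius_inverse_mult_le:
  fixes A B M :: "real mat"
  assumes carrier: "A \<in> carrier_mat n n" "B \<in> carrier_mat n n" "M \<in> carrier_mat n n"
    and inv: "M * B = 1\<^sub>m n" "B * M = 1\<^sub>m n"
    and "n > 0" "0 \<le> C"
    and le: "\<And>x. x \<in> carrier_vec n \<Longrightarrow>
      (\<Sum>r<n. ((A *\<^sub>v x) $ r)\<^sup>2) \<le> C\<^sup>2 * (\<Sum>r<n. ((M *\<^sub>v x) $ r)\<^sup>2)"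
  shows "spectral_radius (map_mat complex_of_real (B * A)) \<le> C"
proof -
  let ?h = "map_mat complex_of_real"
  let ?q = "\<lambda>w :: complex vec. \<Sum>r<n. (norm (w $ r))\<^sup>2"
  have hc: "?h A \<in> carrier_mat n n" "?h B \<in> carrier_mat n n" "?h M \<in> carrier_mat n n"
    using carrier by auto
  have hBA: "?h (B * A) = ?h B * ?h A"
    by (rule of_real_hom.mat_hom_mult[OF carrier(2,1)])
  have hMB: "?h M * ?h B = 1\<^sub>m n" "?h B * ?h M = 1\<^sub>m n"
    by (simp_all only: of_real_hom.mat_hom_mult[OF carrier(3,2), symmetric]
        of_real_hom.mat_hom_mult[OF carrier(2,3), symmetric] inv of_real_hom.mat_hom_one)
  have carBA: "?h (B * A) \<in> carrier_mat n n" using carrier by auto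
  obtain \<mu> where \<mu>: "\<mu> \<in> spectrum (?h (B * A))" "spectral_radius (?h (B * A)) = norm \<mu>"
    using spectral_radius_mem_max(1)[OF carBA \<open>n > 0\<close>] by auto
  then obtain v where v: "v \<in> carrier_vec n" "v \<noteq> 0\<^sub>v n" "?h (B * A) *\<^sub>v v = \<mu> \<cdot>\<^sub>v v"
    using carBA unfolding spectrum_def eigenvalue_def eigenvector_def by auto
  have Mv: "?h M *\<^sub>v v \<in> carrier_vec n" using hc(3) v(1) by auto
  \<comment> \<open>Inserting \<open>M * B = 1\<close> turns the eigenvalue equation for
    \<open>B * A\<close> into a generalized one for the pair \<open>A\<close>, \<open>M\<close>,
    from which the inverse has disappeared.\<close>
  have "?h A *\<^sub>v v = (?h M * ?h B) *\<^sub>v (?h A *\<^sub>v v)"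
    using hc v(1) by (simp add: hMB)
  also have "\<dots> = ?h M *\<^sub>v (?h (B * A) *\<^sub>v v)"
    using hc v(1) by (simp add: hBA assoc_mult_mat_vec[of _ n n _ n])
  also have "\<dots> = \<mu> \<cdot>\<^sub>v (?h M *\<^sub>v v)"
    using hc v by (simp add: mult_mat_vec)
  finally have eq: "?h A *\<^sub>v v = \<mu> \<cdot>\<^sub>v (?h M *\<^sub>v v)" .
  have qA: "?q (?h A *\<^sub>v v) = (norm \<mu>)\<^sup>2 * ?q (?h M *\<^sub>v v)"
    unfolding eq sum_distrib_left
    using carrier(3) by (intro sum.cong) (auto simp: norm_mult power_mult_distrib)
  have "?q (?h A *\<^sub>v v) \<le> C\<^sup>2 * ?q (?h M *\<^sub>v v)"
    unfolding sum_norm_square_of_real_mult_vec[OF carrier(1) v(1)]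
      sum_norm_square_of_real_mult_vec[OF carrier(3) v(1)] distrib_left
    using v(1) by (intro add_mono le) auto
  moreover have "?q (?h M *\<^sub>v v) > 0"
  proof -
    have "?h M *\<^sub>v v \<noteq> 0\<^sub>v n"
    proof
      assume "?h M *\<^sub>v v = 0\<^sub>v n"
      moreover have "?h B *\<^sub>v 0\<^sub>v n = 0\<^sub>v n"
        using hc(2) by (intro eq_vecI) auto
      ultimately have "(?h B * ?h M) *\<^sub>v v = 0\<^sub>v n"
        using hc v(1) by (simp add: assoc_mult_mat_vec[of _ n n _ n])
      then show False using v(1,2) by (simp add: hMB)
    qed
    then obtain r where "r < n" "(?h M *\<^sub>v v) $ r \<noteq> 0"
      using Mv by (metis carrier_vecD eq_vecI index_zero_vec)
    then show ?thesis by (intro sum_pos2[of _ r]) auto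
  qed
  ultimately have "(norm \<mu>)\<^sup>2 \<le> C\<^sup>2" unfolding qA by simp
  then show ?thesis using \<mu>(2) \<open>0 \<le> C\<close> power2_le_imp_le by auto
qed

section \<open>The two matrices in coordinates\<close>

text \<open>Induction peels off the leading 2 by 2 block and shifts both indices by 2. Below
  \<open>2 * m + 1\<close> only the index \<open>2 * m\<close> has quotient \<open>m\<close>, so
  equal quotients mean equal blocks even for the final 1 by 1 block.\<close>

lemma diag_block_mat_replicate_snoc_index:
  assumes "B \<in> carrier_mat 2 2" "D \<in> carrier_mat 1 1" "r < 2 * m + 1" "k < 2 * m + 1"
  shows "diag_block_mat (replicate m B @ [D]) $$ (r, k) =
    (if r div 2 = k div 2 then if r = 2 * m then D $$ (0, 0) else B $$ (r mod 2, k mod 2) else 0)"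
  using assms(3,4)
proof (induction m arbitrary: r k)
  case 0
  then show ?case using assms(2) by auto
next
  case (Suc m)
  let ?D = "diag_block_mat (replicate m B @ [D])"
  have dim: "dim_row ?D = 2 * m + 1" "dim_col ?D = 2 * m + 1"
    using assms by (simp_all add: dim_diag_block_mat sum_list_replicate)
  have sm: "s < 2 \<or> (\<exists>t. s = t + 2)" for s :: nat
    by presburger
  from sm[of r] sm[of k] show ?case
    using assms(1,2) Suc.prems Suc.IH[of "r - 2" "k - 2"]
    by (auto simp: Let_def dim)
qed

text \<open>Here \<open>m\<close> is the number of interior fractures: indices
  \<open>2 * i + 1\<close> and \<open>2 * i + 2\<close> are the two traces of the
  \<open>i\<close>-th one, counted from 0, and the indices 0 and \<open>2 * m + 1\<close> belong to
  the end fractures.\<close>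

lemma osm_M_action:
  fixes L \<gamma>1 \<gamma>2 p :: real
  assumes x: "x \<in> carrier_vec (2 * m + 2)"
  defines "y \<equiv> osm_M (m + 2) L \<gamma>1 \<gamma>2 p *\<^sub>v x" and "b \<equiv> 1 / (\<gamma>2 - \<gamma>1)"
  shows "y $ 0 = (p + L / (\<gamma>2 * (L - \<gamma>2))) * x $ 0"
    and "i < m \<Longrightarrow> y $ (2 * i + 1) =
      (p + \<gamma>2 / (\<gamma>1 * (\<gamma>2 - \<gamma>1))) * x $ (2 * i + 1) - b * x $ (2 * i + 2)"
    and "i < m \<Longrightarrow> y $ (2 * i + 2) =
      (p + (L - \<gamma>1) / ((L - \<gamma>2) * (\<gamma>2 - \<gamma>1))) * x $ (2 * i + 2) - b * x $ (2 * i + 1)"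
    and "y $ (2 * m + 1) = (p + L / (\<gamma>1 * (L - \<gamma>1))) * x $ (2 * m + 1)"
proof -
  let ?n = "2 * m + 2"
  define M where "M = osm_M (m + 2) L \<gamma>1 \<gamma>2 p"
  let ?D = "diag_block_mat (replicate m (blockF2 L \<gamma>1 \<gamma>2 p) @ [blockF4 L \<gamma>1 p])"
  have F1: "blockF1 L \<gamma>2 p \<in> carrier_mat 1 1" and F2: "blockF2 L \<gamma>1 \<gamma>2 p \<in> carrier_mat 2 2"
    and F4: "blockF4 L \<gamma>1 p \<in> carrier_mat 1 1"
    by (auto simp: blockF1_def blockF2_def blockF4_def mat_of_rows_list_def)
  have dim: "dim_row ?D = 2 * m + 1" "dim_col ?D = 2 * m + 1"
    using F2 F4 by (simp_all add: dim_diag_block_mat sum_list_replicate)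
  have entry: "M $$ (r, k) = (if r = 0 \<or> k = 0
      then if r = k then blockF1 L \<gamma>2 p $$ (0, 0) else 0
      else if (r - 1) div 2 = (k - 1) div 2
      then if r = 2 * m + 1 then blockF4 L \<gamma>1 p $$ (0, 0)
        else blockF2 L \<gamma>1 \<gamma>2 p $$ ((r - 1) mod 2, (k - 1) mod 2) else 0)"
    if "r < ?n" "k < ?n" for r k
    using that F1 diag_block_mat_replicate_snoc_index[OF F2 F4, of "r - 1" m "k - 1"]
    by (auto simp: M_def osm_M_def Let_def dim)
  have carM: "M \<in> carrier_mat ?n ?n"
    using osm_M_carrier[of "m + 2"] by (simp add: M_def osm_dim_def)
  have row1: "y $ r = u * x $ k"
    if "r < ?n" "k < ?n" "\<And>j. j < ?n \<Longrightarrow> M $$ (r, j) = (if j = k then u else 0)" for r k u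
  proof -
    have "y $ r = (\<Sum>j = 0..<?n. (if j = k then u else 0) * x $ j)"
      unfolding y_def M_def[symmetric] mat_vec_row[OF carM x that(1)]
      by (rule sum.cong) (simp_all only: that atLeastLessThan_iff)
    then show ?thesis by (simp only: sum_one_delta[OF that(2)])
  qed
  have row2: "y $ r = u * x $ k + v * x $ l"
    if "r < ?n" "k < ?n" "l < ?n" "k \<noteq> l"
      "\<And>j. j < ?n \<Longrightarrow> M $$ (r, j) = (if j = k then u else if j = l then v else 0)" for r k l u v
  proof -
    have "y $ r = (\<Sum>j = 0..<?n. (if j = k then u else if j = l then v else 0) * x $ j)"
      unfolding y_def M_def[symmetric] mat_vec_row[OF carM x that(1)]
      by (rule sum.cong) (simp_all only: that atLeastLessThan_iff)
    then show ?thesis by (simp only: sum_two_deltas[OF that(2-4)])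
  qed
  show "y $ 0 = (p + L / (\<gamma>2 * (L - \<gamma>2))) * x $ 0"
    by (rule row1) (auto simp: entry blockF1_def mat_of_rows_list_def)
  show "y $ (2 * m + 1) = (p + L / (\<gamma>1 * (L - \<gamma>1))) * x $ (2 * m + 1)"
  proof (rule row1)
    fix j assume "j < ?n"
    \<comment> \<open>The case \<open>j = 0\<close> is kept apart because truncated subtraction
      gives \<open>(0 - 1) div 2 = 0\<close>, which would match \<open>m = 0\<close>.\<close>
    moreover have "j = 0 \<or> (j - 1) div 2 = m \<longleftrightarrow> j = 0 \<or> j = 2 * m + 1"
      using \<open>j < ?n\<close> by presburger
    ultimately show "M $$ (2 * m + 1, j) =
      (if j = 2 * m + 1 then p + L / (\<gamma>1 * (L - \<gamma>1)) else 0)"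
      by (auto simp: entry blockF4_def mat_of_rows_list_def)
  qed auto
  have cases: "j = 0 \<or> j = 2 * i + 1 \<or> j = 2 * i + 2 \<or> j > 0 \<and> (j - 1) div 2 \<noteq> i" for j
    by presburger
  show "y $ (2 * i + 1) =
    (p + \<gamma>2 / (\<gamma>1 * (\<gamma>2 - \<gamma>1))) * x $ (2 * i + 1) - b * x $ (2 * i + 2)" if "i < m"
  proof -
    have "y $ (2 * i + 1) =
      (p + \<gamma>2 / (\<gamma>1 * (\<gamma>2 - \<gamma>1))) * x $ (2 * i + 1) + (- b) * x $ (2 * i + 2)"
    proof (rule row2)
      show "M $$ (2 * i + 1, j) = (if j = 2 * i + 1 then p + \<gamma>2 / (\<gamma>1 * (\<gamma>2 - \<gamma>1))
        else if j = 2 * i + 2 then - b else 0)" if "j < ?n" for j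
        using cases[of j] \<open>i < m\<close> that
        by (auto simp: entry blockF2_def mat_of_rows_list_def b_def)
    qed (use that in auto)
    then show ?thesis by simp
  qed
  show "y $ (2 * i + 2) =
    (p + (L - \<gamma>1) / ((L - \<gamma>2) * (\<gamma>2 - \<gamma>1))) * x $ (2 * i + 2) - b * x $ (2 * i + 1)" if "i < m"
  proof -
    have "y $ (2 * i + 2) = (p + (L - \<gamma>1) / ((L - \<gamma>2) * (\<gamma>2 - \<gamma>1))) * x $ (2 * i + 2) +
      (- b) * x $ (2 * i + 1)"
    proof (rule row2)
      show "M $$ (2 * i + 2, j) =
        (if j = 2 * i + 2 then p + (L - \<gamma>1) / ((L - \<gamma>2) * (\<gamma>2 - \<gamma>1))
         else if j = 2 * i + 1 then - b else 0)" if "j < ?n" for j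
        using cases[of j] \<open>i < m\<close> that
        by (auto simp: entry blockF2_def mat_of_rows_list_def b_def)
    qed (use that in auto)
    then show ?thesis by simp
  qed
qed

text \<open>The grouping follows the blocks of \<open>osm_M\<close>: one index for each end
  fracture, a pair for each interior one.\<close>

lemma sum_lessThan_paired:
  fixes f :: "nat \<Rightarrow> real"
  shows "(\<Sum>r<2 * m + 2. f r) = f 0 + (\<Sum>i<m. f (2 * i + 1) + f (2 * i + 2)) + f (2 * m + 1)"
  by (induction m) (simp_all add: algebra_simps numeral_2_eq_2)

text \<open>Each row holds the datum that a trace receives from a neighbour. A sum of squares
  ignores the order of the rows, so they can be regrouped by the fracture that sends the data; this
  is where the row permutation relating \<open>osm_N\<close> to p - K drops out.\<close>

lemma sum_square_osm_N:
  fixes L \<gamma>1 \<gamma>2 p :: real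
  assumes x: "x \<in> carrier_vec (2 * m + 2)" and m: "m \<ge> 1"
  defines "a \<equiv> coef_a \<gamma>1 \<gamma>2 p" and "b \<equiv> coef_b \<gamma>1 \<gamma>2" and "c \<equiv> coef_c L \<gamma>1 \<gamma>2 p"
  shows "(\<Sum>r<2 * m + 2. ((osm_N (m + 2) L \<gamma>1 \<gamma>2 p *\<^sub>v x) $ r)\<^sup>2) =
    (coef_d L \<gamma>2 p * x $ 0)\<^sup>2 + (coef_d L \<gamma>1 p * x $ (2 * m + 1))\<^sup>2 +
    (\<Sum>i<m. (a * x $ (2 * i + 1) + b * x $ (2 * i + 2))\<^sup>2 + (b * x $ (2 * i + 1) + c * x $ (2 * i + 2))\<^sup>2)"
proof -
  obtain k where k: "m = Suc k" using m by (cases m) auto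
  let ?y = "osm_N (m + 2) L \<gamma>1 \<gamma>2 p *\<^sub>v x"
  have x': "x \<in> carrier_vec (osm_dim (m + 2))" using x by (simp add: osm_dim_def)
  have m3: "3 \<le> m + 2" using m by simp
  note act = osm_N_action[where L = L and ?\<gamma>1.0 = \<gamma>1 and ?\<gamma>2.0 = \<gamma>2 and p = p,
      OF m3 x', folded a_def b_def c_def]
  let ?P = "\<lambda>i. a * x $ (2 * i + 1) + b * x $ (2 * i + 2)"
  let ?Q = "\<lambda>i. b * x $ (2 * i + 1) + c * x $ (2 * i + 2)"
  have "?y $ 0 = ?P 0" "?y $ 1 = coef_d L \<gamma>2 p * x $ 0"
    "?y $ (2 * m) = coef_d L \<gamma>1 p * x $ (2 * m + 1)" "?y $ (2 * m + 1) = ?Q k"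
    using act(1,2,5,6) by (simp_all add: k numeral_2_eq_2)
  moreover have "?y $ (2 * i + 3) = ?Q i" if "i < k" for i
    using act(3)[of "i + 3"] that by (simp add: k algebra_simps numeral_eq_Suc)
  moreover have "?y $ (2 * i + 2) = ?P (i + 1)" if "i < k" for i
    using act(4)[of "i + 2"] that by (simp add: k algebra_simps numeral_eq_Suc)
  \<comment> \<open>Rows 1 and \<open>2 * m\<close>, fed by the end fractures, are split off. The
    remaining odd rows, including the last, carry all the \<open>?Q i\<close>; the remaining even
    rows, including row 0, carry all the \<open>?P i\<close>.\<close>
  moreover have "(\<Sum>i<m. (?y $ (2 * i + 1))\<^sup>2) = (?y $ 1)\<^sup>2 + (\<Sum>i<k. (?y $ (2 * i + 3))\<^sup>2)"
    unfolding k sum.lessThan_Suc_shift by (simp add: algebra_simps numeral_eq_Suc)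
  moreover have "(\<Sum>i<m. (?y $ (2 * i + 2))\<^sup>2) = (\<Sum>i<k. (?y $ (2 * i + 2))\<^sup>2) + (?y $ (2 * m))\<^sup>2"
    unfolding k by simp
  moreover have "(\<Sum>i<m. (?P i)\<^sup>2) = (?P 0)\<^sup>2 + (\<Sum>i<k. (?P (i + 1))\<^sup>2)"
    unfolding k sum.lessThan_Suc_shift by simp
  moreover have "(\<Sum>i<m. (?Q i)\<^sup>2) = (\<Sum>i<k. (?Q i)\<^sup>2) + (?Q k)\<^sup>2"
    unfolding k by simp
  ultimately show ?thesis
    unfolding sum_lessThan_paired sum.distrib by simp
qed

text \<open>The symmetric matrix with diagonal \<open>\<alpha>\<close> and off-diagonal \<open>-b\<close> has the orthogonal eigenvectors
  \<open>(1, 1)\<close> and \<open>(1, -1)\<close>, with eigenvalues \<open>\<alpha> - b\<close> and \<open>\<alpha> + b\<close>.\<close>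

lemma symmetric_pair_bound:
  fixes \<alpha> b p C u v :: real
  assumes "(p - (\<alpha> - b))\<^sup>2 \<le> C\<^sup>2 * (p + (\<alpha> - b))\<^sup>2" "(p - (\<alpha> + b))\<^sup>2 \<le> C\<^sup>2 * (p + (\<alpha> + b))\<^sup>2"
  shows "((p - \<alpha>) * u + b * v)\<^sup>2 + (b * u + (p - \<alpha>) * v)\<^sup>2 \<le>
    C\<^sup>2 * (((p + \<alpha>) * u - b * v)\<^sup>2 + ((p + \<alpha>) * v - b * u)\<^sup>2)"
proof -
  \<comment> \<open>Parseval in the eigenbasis: \<open>u + v\<close> and \<open>u - v\<close> are
    the coordinates along (1, 1) and (1, -1), and the factor 2 is the squared length of these
    vectors.\<close>
  have "2 * (((p - \<alpha>) * u + b * v)\<^sup>2 + (b * u + (p - \<alpha>) * v)\<^sup>2) =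
    (p - (\<alpha> - b))\<^sup>2 * (u + v)\<^sup>2 + (p - (\<alpha> + b))\<^sup>2 * (u - v)\<^sup>2"
    by (simp add: power2_eq_square algebra_simps)
  also have "\<dots> \<le> (C\<^sup>2 * (p + (\<alpha> - b))\<^sup>2) * (u + v)\<^sup>2 + (C\<^sup>2 * (p + (\<alpha> + b))\<^sup>2) * (u - v)\<^sup>2"
    using assms by (intro add_mono mult_right_mono) auto
  also have "\<dots> = 2 * (C\<^sup>2 * (((p + \<alpha>) * u - b * v)\<^sup>2 + ((p + \<alpha>) * v - b * u)\<^sup>2))"
    by (simp add: power2_eq_square algebra_simps)
  finally show ?thesis by simp
qed

text \<open>Adding and subtracting the equations diagonalises the system, with eigenvalues
  \<open>q - b\<close> and \<open>q + b\<close>.\<close>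

lemma symmetric_pair_injective:
  fixes q b u v :: real
  assumes "q * u - b * v = 0" "q * v - b * u = 0" "q - b \<noteq> 0" "q + b \<noteq> 0"
  shows "u = 0" "v = 0"
proof -
  have "(q - b) * (u + v) = 0" "(q + b) * (u - v) = 0"
    using assms(1,2) by (simp_all add: algebra_simps)
  then show "u = 0" "v = 0" using assms(3,4) by auto
qed

section \<open>Estimates for symmetrically placed traces\<close>

locale symmetric_staircase =
  fixes L \<gamma>1 \<gamma>2 p :: real
  assumes pos: "0 < \<gamma>1" "\<gamma>1 < \<gamma>2" "0 < p" and sum_eq: "\<gamma>1 + \<gamma>2 = L"
begin

text \<open>These are the entries of K: \<alpha> on the diagonal of every interior block,
  \<open>- b\<close> off it, and \<beta> in both end blocks. The diagonal entries coincide because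
  reflecting a fracture exchanges its two trace positions.\<close>

definition "\<alpha> = \<gamma>2 / (\<gamma>1 * (\<gamma>2 - \<gamma>1))"
definition "\<beta> = L / (\<gamma>1 * \<gamma>2)"
definition "b = 1 / (\<gamma>2 - \<gamma>1)"

lemma eigenvalues_pos: "0 < \<alpha> - b" "0 < \<alpha> + b" "0 < \<beta>"
proof -
  \<comment> \<open>The smaller eigenvalue of an interior block thus equals
    \<open>1 / \<gamma>1\<close>.\<close>
  have "\<alpha> - b = (\<gamma>2 - \<gamma>1) / (\<gamma>1 * (\<gamma>2 - \<gamma>1))"
    using pos by (simp add: \<alpha>_def b_def diff_divide_distrib)
  then show "0 < \<alpha> - b" using pos by simp
  moreover have "0 < b" using pos by (simp add: b_def)
  ultimately show "0 < \<alpha> + b" by simp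
  show "0 < \<beta>" using pos sum_eq by (auto simp: \<beta>_def intro!: divide_pos_pos)
qed

lemma L_minus: "L - \<gamma>1 = \<gamma>2" "L - \<gamma>2 = \<gamma>1"
  using sum_eq by auto

lemma coefs:
  "coef_a \<gamma>1 \<gamma>2 p = p - \<alpha>" "coef_c L \<gamma>1 \<gamma>2 p = p - \<alpha>" "coef_b \<gamma>1 \<gamma>2 = b"
  "coef_d L \<gamma>1 p = p - \<beta>" "coef_d L \<gamma>2 p = p - \<beta>"
  by (simp_all add: coef_a_def coef_b_def coef_c_def coef_d_def \<alpha>_def b_def \<beta>_def L_minus
      mult.commute)

lemma M_action:
  assumes "x \<in> carrier_vec (2 * m + 2)"
  defines "y \<equiv> osm_M (m + 2) L \<gamma>1 \<gamma>2 p *\<^sub>v x"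
  shows "y $ 0 = (p + \<beta>) * x $ 0"
    and "i < m \<Longrightarrow> y $ (2 * i + 1) = (p + \<alpha>) * x $ (2 * i + 1) - b * x $ (2 * i + 2)"
    and "i < m \<Longrightarrow> y $ (2 * i + 2) = (p + \<alpha>) * x $ (2 * i + 2) - b * x $ (2 * i + 1)"
    and "y $ (2 * m + 1) = (p + \<beta>) * x $ (2 * m + 1)"
  using osm_M_action[where L = L and ?\<gamma>1.0 = \<gamma>1 and ?\<gamma>2.0 = \<gamma>2 and p = p,
      OF assms(1), unfolded L_minus]
  by (simp_all add: y_def \<alpha>_def \<beta>_def b_def mult.commute)

lemma M_carrier: "osm_M (m + 2) L \<gamma>1 \<gamma>2 p \<in> carrier_mat (2 * m + 2) (2 * m + 2)"
  using osm_M_carrier[of "m + 2"] by (simp add: osm_dim_def)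

text \<open>The system decouples into the blocks of \<open>osm_M\<close>, whose eigenvalues p +
  \<kappa> are all positive.\<close>

lemma M_injective:
  assumes x: "x \<in> carrier_vec (2 * m + 2)"
    and zero: "osm_M (m + 2) L \<gamma>1 \<gamma>2 p *\<^sub>v x = 0\<^sub>v (2 * m + 2)"
  shows "x = 0\<^sub>v (2 * m + 2)"
proof (rule eq_vecI)
  note act = M_action[OF x, unfolded zero]
  have pair: "x $ (2 * i + 1) = 0 \<and> x $ (2 * i + 2) = 0" if i: "i < m" for i
    using symmetric_pair_injective[of "p + \<alpha>" "x $ (2 * i + 1)" b "x $ (2 * i + 2)"]
      act(2,3)[OF i] i eigenvalues_pos pos by auto
  fix r assume "r < dim_vec (0\<^sub>v (2 * m + 2) :: real vec)"
  then have "r = 0 \<or> r = 2 * m + 1 \<or> (\<exists>i<m. r = 2 * i + 1 \<or> r = 2 * i + 2)"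
    by simp presburger
  then show "x $ r = 0\<^sub>v (2 * m + 2) $ r"
    using act(1,4) pair eigenvalues_pos pos by auto
qed (use x in simp)

text \<open>Both sides split into the same sum over fractures, so the bound is checked on one block
  at a time and its constant does not depend on \<open>m\<close>.\<close>

lemma sum_square_N_le:
  assumes x: "x \<in> carrier_vec (2 * m + 2)" and m: "m \<ge> 1"
    and C: "\<And>\<kappa>. \<kappa> \<in> {\<alpha> - b, \<alpha> + b, \<beta>} \<Longrightarrow> (p - \<kappa>)\<^sup>2 \<le> C\<^sup>2 * (p + \<kappa>)\<^sup>2"
  shows "(\<Sum>r<2 * m + 2. ((osm_N (m + 2) L \<gamma>1 \<gamma>2 p *\<^sub>v x) $ r)\<^sup>2) \<le>
    C\<^sup>2 * (\<Sum>r<2 * m + 2. ((osm_M (m + 2) L \<gamma>1 \<gamma>2 p *\<^sub>v x) $ r)\<^sup>2)"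
proof -
  let ?y = "osm_M (m + 2) L \<gamma>1 \<gamma>2 p *\<^sub>v x"
  have "((p - \<beta>) * u)\<^sup>2 \<le> C\<^sup>2 * ((p + \<beta>) * u)\<^sup>2" for u
    using mult_right_mono[OF C[of \<beta>], of "u\<^sup>2"] by (simp add: power_mult_distrib mult.assoc)
  moreover have "(\<Sum>i<m. ((p - \<alpha>) * x $ (2 * i + 1) + b * x $ (2 * i + 2))\<^sup>2 +
        (b * x $ (2 * i + 1) + (p - \<alpha>) * x $ (2 * i + 2))\<^sup>2) \<le>
      C\<^sup>2 * (\<Sum>i<m. (?y $ (2 * i + 1))\<^sup>2 + (?y $ (2 * i + 2))\<^sup>2)"
    unfolding sum_distrib_left
  proof (rule sum_mono)
    fix i assume "i \<in> {..<m}"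
    then have i: "i < m" by simp
    show "((p - \<alpha>) * x $ (2 * i + 1) + b * x $ (2 * i + 2))\<^sup>2 +
        (b * x $ (2 * i + 1) + (p - \<alpha>) * x $ (2 * i + 2))\<^sup>2 \<le>
      C\<^sup>2 * ((?y $ (2 * i + 1))\<^sup>2 + (?y $ (2 * i + 2))\<^sup>2)"
      unfolding M_action(2,3)[OF x i] by (rule symmetric_pair_bound; rule C; simp)
  qed
  ultimately show ?thesis
    unfolding sum_square_osm_N[OF x m] coefs sum_lessThan_paired[where f = "\<lambda>r. (?y $ r)\<^sup>2"]
      M_action(1,4)[OF x] distrib_left
    by (smt (verit))
qed

lemma spectral_radius_osm_T_le:
  assumes "N \<ge> 3" "0 \<le> C"
    and C: "\<And>\<kappa>. \<kappa> \<in> {\<alpha> - b, \<alpha> + b, \<beta>} \<Longrightarrow> (p - \<kappa>)\<^sup>2 \<le> C\<^sup>2 * (p + \<kappa>)\<^sup>2"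
  shows "spectral_radius (map_mat complex_of_real (osm_T N L \<gamma>1 \<gamma>2 p)) \<le> C"
proof -
  obtain m where N: "N = m + 2" and m: "m \<ge> 1"
    using \<open>N \<ge> 3\<close> by (intro that[of "N - 2"]) auto
  let ?M = "osm_M N L \<gamma>1 \<gamma>2 p" and ?n = "2 * m + 2"
  have M: "?M \<in> carrier_mat ?n ?n" using M_carrier by (simp add: N)
  \<comment> \<open>Invertibility ensures that \<open>mat_inverse\<close> returns
    \<open>Some B\<close>, so that \<open>the\<close> in \<open>osm_T\<close> yields the true
    inverse.\<close>
  have "det ?M \<noteq> 0"
    using det_0_iff_vec_prod_zero_field[OF M] M_injective unfolding N by blast
  then have "?M \<in> Units (ring_mat TYPE(real) ?n ())"
    by (rule det_non_zero_imp_unit[OF M])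
  then obtain B where B: "mat_inverse ?M = Some B"
    using mat_inverse(1)[OF M, of "()"] by (cases "mat_inverse ?M") auto
  then have inv: "?M * B = 1\<^sub>m ?n" "B * ?M = 1\<^sub>m ?n" "B \<in> carrier_mat ?n ?n"
    using mat_inverse(2)[OF M] by auto
  have A: "osm_N N L \<gamma>1 \<gamma>2 p \<in> carrier_mat ?n ?n"
    using osm_N_carrier[of "m + 2"] by (simp add: N osm_dim_def)
  show ?thesis
    unfolding osm_T_def B option.sel
    by (rule spectral_radius_inverse_mult_le[OF A inv(3) M inv(1,2)])
      (use sum_square_N_le[OF _ m C] \<open>0 \<le> C\<close> in \<open>auto simp: N\<close>)
qed

end

section \<open>The constant uniform in the number of fractures\<close>

theorem theorem1:
  fixes L \<gamma>1 \<gamma>2 :: real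
  assumes "0 < \<gamma>1" and "\<gamma>1 < \<gamma>2" and "\<gamma>2 < L" and "\<gamma>1 + \<gamma>2 = L"
  shows "\<forall>p::real. p > 0 \<longrightarrow> (\<exists>C::real. C < 1 \<and> (\<forall>N::nat. N \<ge> 3 \<longrightarrow>
           spectral_radius (map_mat complex_of_real (osm_T N L \<gamma>1 \<gamma>2 p)) \<le> C))"
proof (intro allI impI)
  fix p :: real
  assume "p > 0"
  then interpret symmetric_staircase L \<gamma>1 \<gamma>2 p
    using assms by unfold_locales auto
  define S where "S = {\<alpha> - b, \<alpha> + b, \<beta>}"
  define C where "C = Max ((\<lambda>\<kappa>. \<bar>p - \<kappa>\<bar> / (p + \<kappa>)) ` S)"
  have pos_S: "\<kappa> > 0" if "\<kappa> \<in> S" for \<kappa>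
    using that eigenvalues_pos by (auto simp: S_def)
  have fin: "finite S" "S \<noteq> {}" by (auto simp: S_def)
  have ge: "\<bar>p - \<kappa>\<bar> / (p + \<kappa>) \<le> C" if "\<kappa> \<in> S" for \<kappa>
    using that fin by (auto simp: C_def)
  \<comment> \<open>Nonnegativity of \<open>C\<close> is what later allows the bound on squares to
    be turned into one on moduli.\<close>
  have "0 \<le> \<bar>p - \<beta>\<bar> / (p + \<beta>)"
    using \<open>p > 0\<close> eigenvalues_pos(3) by simp
  then have "0 \<le> C" using ge[of \<beta>] by (simp add: S_def)
  have "C < 1"
    \<comment> \<open>For positive p and \<kappa> one has \<bar>p - \<kappa>\<bar> < p + \<kappa>,
      and the strict inequality survives the maximum because \<open>S\<close> is finite.\<close>
    unfolding C_def using fin \<open>p > 0\<close> by (auto dest!: pos_S simp: field_simps)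
  have "(p - \<kappa>)\<^sup>2 \<le> C\<^sup>2 * (p + \<kappa>)\<^sup>2" if "\<kappa> \<in> S" for \<kappa>
  proof -
    have "\<bar>p - \<kappa>\<bar> \<le> C * (p + \<kappa>)"
      using ge[OF that] pos_S[OF that] \<open>p > 0\<close> by (simp add: pos_divide_le_eq)
    then show ?thesis
      using power_mono[of "\<bar>p - \<kappa>\<bar>" "C * (p + \<kappa>)" 2] by (simp add: power_mult_distrib)
  qed
  then show "\<exists>C<1. \<forall>N\<ge>3. spectral_radius (map_mat complex_of_real (osm_T N L \<gamma>1 \<gamma>2 p)) \<le> C"
    using spectral_radius_osm_T_le[OF _ \<open>0 \<le> C\<close>] \<open>C < 1\<close> unfolding S_def by blast
qed

end
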